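(* The group $\mathcal{E}$ contains no distortion elements.
   Context: Identify $\mathbb{T}^1=\mathbb{R}/\mathbb{Z}$ with $[0,1)$. An interval exchange transformation is a bijection $f:\mathbb{T}^1\to\mathbb{T}^1$ for which there is a partition of $[0,1)$ into finitely many half-open intervals $[a,b)$ on each of which $f$ is a translation $x\mapsto x+c \pmod 1$. $\mathcal{E}$ is the group of all interval exchange transformations under composition. For a finitely generated group $G$ with finite generating set $S$, an element $f\in G$ is a distortion element if $f$ has infinite order and $\liminf_{n\to\infty}|f^n|_S/n=0$, where $|\cdot|_S$ is word length with respect to $S\cup S^{-1}$. For an arbitrary group $G$, $f\in G$ is a distortion element in $G$ if it is a distortion element in some finitely generated subgroup of $G$. *)

theory Defs
  imports "HOL-Analysis.Analysis" "HOL-Library.Liminf_Limsup"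
begin

text \<open>The circle T^1 = R/Z is identified with [0,1); maps are real functions
  that act on [0,1) and are the identity outside [0,1), so that composition of
  such maps is composition in the group.\<close>

definition is_iet :: "(real \<Rightarrow> real) \<Rightarrow> bool" where
  "is_iet f \<longleftrightarrow>
     bij_betw f {0..<1} {0..<1} \<and>
     (\<forall>x. x \<notin> {0..<1} \<longrightarrow> f x = x) \<and>
     (\<exists>a :: nat \<Rightarrow> real. \<exists>k. a 0 = 0 \<and> a k = 1 \<and>
        (\<forall>i<k. a i < a (Suc i)) \<and>
        (\<forall>i<k. \<exists>c. \<forall>x \<in> {a i..<a (Suc i)}. f x = frac (x + c)))"

definition IET :: "(real \<Rightarrow> real) set" where
  "IET = {f. is_iet f}"

definition iet_inv :: "(real \<Rightarrow> real) \<Rightarrow> real \<Rightarrow> real" where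
  "iet_inv f = (\<lambda>x. if x \<in> {0..<1} then inv_into {0..<1} f x else x)"

definition sym_gens :: "(real \<Rightarrow> real) set \<Rightarrow> (real \<Rightarrow> real) set" where
  "sym_gens S = S \<union> iet_inv ` S"

definition eval_word :: "(real \<Rightarrow> real) list \<Rightarrow> real \<Rightarrow> real" where
  "eval_word ws = foldr (\<circ>) ws id"

definition words_for :: "(real \<Rightarrow> real) set \<Rightarrow> (real \<Rightarrow> real) \<Rightarrow> (real \<Rightarrow> real) list set" where
  "words_for S g = {ws. set ws \<subseteq> sym_gens S \<and> eval_word ws = g}"

definition gen_subgroup :: "(real \<Rightarrow> real) set \<Rightarrow> (real \<Rightarrow> real) set" where
  "gen_subgroup S = {g. words_for S g \<noteq> {}}"

definition word_length :: "(real \<Rightarrow> real) set \<Rightarrow> (real \<Rightarrow> real) \<Rightarrow> nat" where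
  "word_length S g = (LEAST n. \<exists>ws \<in> words_for S g. length ws = n)"

definition infinite_order :: "(real \<Rightarrow> real) \<Rightarrow> bool" where
  "infinite_order f \<longleftrightarrow> (\<forall>n::nat. n > 0 \<longrightarrow> f ^^ n \<noteq> id)"

definition distortion_fg :: "(real \<Rightarrow> real) set \<Rightarrow> (real \<Rightarrow> real) \<Rightarrow> bool" where
  "distortion_fg S f \<longleftrightarrow>
     f \<in> gen_subgroup S \<and> infinite_order f \<and>
     liminf (\<lambda>n::nat. ereal (real (word_length S (f ^^ n)) / real n)) = 0"

definition distortion_in_IET :: "(real \<Rightarrow> real) \<Rightarrow> bool" where
  "distortion_in_IET f \<longleftrightarrow>
     (\<exists>S. finite S \<and> S \<subseteq> IET \<and> distortion_fg S f)"

end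

theory Submission
  imports Defs
begin

text \<open>
  Extended by the identity to the real line, an interval exchange \<open>f\<close> is a piecewise translation
  with right values \<open>f\<close> and left limits \<open>left_val f\<close>. The word length of \<open>f ^^ n\<close> bounds, up to a
  constant, both the number of its breaks and the norm of its displacements \<open>(f ^^ n) x - x\<close> in the
  finitely generated group of reals spanned by the displacements of the generators.

  If \<open>f ^^ n\<close> has sublinearly many breaks along some sequence, then at every break \<open>p\<close> with no
  earlier break on its orbit the left and right orbits of \<open>p\<close> merge again. Consequently, away from a
  finite set \<open>W\<close>, the maps \<open>f ^^ n\<close> have boundedly many breaks with jumps from a finite set, and
  the displacement of \<open>f ^^ n\<close> varies by at most a constant \<open>B\<close> on each component of the complement
  of \<open>W\<close>, uniformly in \<open>n\<close>. If \<open>x\<close> and \<open>(f ^^ m) x\<close> lie in the same component, then the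
  displacement over \<open>k * m\<close> steps is \<open>k\<close> times that over \<open>m\<close> steps up to an error \<open>k * B\<close>. So
  sublinear growth forces \<open>(f ^^ m) x - x\<close> to have norm at most \<open>B\<close>, leaving finitely many values.
  All orbits then have bounded size and \<open>f\<close> has finite order.
\<close>

section \<open>Piecewise translations of the real line\<close>

text \<open>Pieces are half-open \<open>[a, b)\<close>, so the displacement is constant just to the
  right of every point, and a discontinuity can show only on the left.\<close>

definition breaks :: "(real \<Rightarrow> real) \<Rightarrow> real set" where
  "breaks f = {x. \<not> (\<forall>\<^sub>F y in at_left x. f y - y = f x - x)}"

text \<open>Germs stand in for an explicit partition, so closure under composition needs no common
  refinement.\<close>

definition piecewise_translation :: "(real \<Rightarrow> real) \<Rightarrow> bool" where
  "piecewise_translation f \<longleftrightarrow>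
     bij f \<and> (\<forall>x. \<forall>\<^sub>F y in at_right x. f y - y = f x - x) \<and> finite (breaks f)"

text \<open>The left limit of \<open>f\<close> at \<open>x\<close>. The description is meaningful
  once the displacement is eventually constant on the left, which
  \<open>piecewise_translation_left\<close> shows at every point.\<close>

definition left_val :: "(real \<Rightarrow> real) \<Rightarrow> real \<Rightarrow> real" where
  "left_val f x = x + (THE c. \<forall>\<^sub>F y in at_left x. f y - y = c)"

lemma left_val_eqI:
  assumes "\<forall>\<^sub>F y in at_left x. f y - y = c"
  shows "left_val f x = x + c"
proof -
  have "d = c" if "\<forall>\<^sub>F y in at_left x. f y - y = d" for d
  proof -
    have "\<forall>\<^sub>F y in at_left x. d = c" using assms that by eventually_elim simp
    then show ?thesis by simp
  qed
  with assms have "(THE c. \<forall>\<^sub>F y in at_left x. f y - y = c) = c"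
    by (intro the_equality)
  then show ?thesis by (simp add: left_val_def)
qed

lemma finite_avoid_left:
  fixes x :: real assumes "finite F"
  shows "\<exists>a<x. {a<..<x} \<inter> F = {}"
proof -
  let ?F = "insert (x - 1) (F \<inter> {..<x})"
  have fin: "finite ?F" using assms by simp
  have "Max ?F < x" using fin by (subst Max_less_iff) auto
  moreover have "{Max ?F<..<x} \<inter> F = {}"
  proof -
    have "y \<le> Max ?F" if "y \<in> F" "y < x" for y using fin that by (intro Max_ge) auto
    then show ?thesis by force
  qed
  ultimately show ?thesis by blast
qed

text \<open>Some interval ending at \<open>x\<close> is free of breaks. There the displacement is
  locally constant, hence constant by connectedness.\<close>

lemma piecewise_translation_left:
  assumes "piecewise_translation f"
  shows "\<forall>\<^sub>F y in at_left x. f y - y = left_val f x - x"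
proof -
  have fin: "finite (breaks f)" and rt: "\<And>x. \<forall>\<^sub>F y in at_right x. f y - y = f x - x"
    using assms by (auto simp: piecewise_translation_def)
  obtain a where a: "a < x" "{a<..<x} \<inter> breaks f = {}"
    using finite_avoid_left[OF fin] by blast
  have "(\<lambda>y. f y - y) constant_on {a<..<x}"
  proof (rule locally_constant_imp_constant)
    fix z assume z: "z \<in> {a<..<x}"
    then have "\<forall>\<^sub>F y in at z. f y - y = f z - z"
      using a rt[of z] by (auto simp: eventually_at_split breaks_def)
    then obtain T where T: "open T" "z \<in> T" "\<forall>y\<in>T. y \<noteq> z \<longrightarrow> f y - y = f z - z"
      by (auto simp: eventually_at_topological)
    show "\<exists>T. openin (top_of_set {a<..<x}) T \<and> z \<in> T \<and> (\<forall>y\<in>T. f y - y = f z - z)"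
      using T z by (intro exI[of _ "{a<..<x} \<inter> T"]) (auto simp: openin_open_Int)
  qed simp
  then obtain c where "\<forall>y\<in>{a<..<x}. f y - y = c" by (auto simp: constant_on_def)
  then have "\<forall>\<^sub>F y in at_left x. f y - y = c"
    using a(1) by (auto simp: eventually_at_left)
  with left_val_eqI[OF this] show ?thesis by simp
qed

lemma breaks_iff_left_val:
  assumes "piecewise_translation f"
  shows "x \<in> breaks f \<longleftrightarrow> left_val f x \<noteq> f x"
proof
  assume "x \<in> breaks f"
  then show "left_val f x \<noteq> f x"
    using piecewise_translation_left[OF assms, of x] by (auto simp: breaks_def)
next
  assume "left_val f x \<noteq> f x"
  then show "x \<in> breaks f"
    using left_val_eqI[of f "f x - x" x] by (auto simp: breaks_def)
qed

section \<open>Composition, iteration and inversion\<close>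

lemma eventually_at_left_translate:
  fixes x d :: real
  shows "(\<forall>\<^sub>F y in at_left x. P (y + d)) \<longleftrightarrow> (\<forall>\<^sub>F z in at_left (x + d). P z)"
proof -
  have "at_left (x + d) = filtermap (\<lambda>y. y + d) (at_left x)"
    using filtermap_at_left_shift[of "-d" x] by simp
  then show ?thesis by (simp add: eventually_filtermap)
qed

lemma eventually_at_right_translate:
  fixes x d :: real
  shows "(\<forall>\<^sub>F y in at_right x. P (y + d)) \<longleftrightarrow> (\<forall>\<^sub>F z in at_right (x + d). P z)"
proof -
  have "at_right (x + d) = filtermap (\<lambda>y. y + d) (at_right x)"
    using filtermap_at_right_shift[of "-d" x] by simp
  then show ?thesis by (simp add: eventually_filtermap)
qed

lemma left_translation_comp:
  fixes f g :: "real \<Rightarrow> real"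
  assumes "\<forall>\<^sub>F y in at_left x. g y - y = d" "\<forall>\<^sub>F z in at_left (x + d). f z - z = c"
  shows "\<forall>\<^sub>F y in at_left x. (f \<circ> g) y - y = d + c"
proof -
  have "\<forall>\<^sub>F y in at_left x. f (y + d) - (y + d) = c"
    using assms(2) by (subst eventually_at_left_translate)
  with assms(1) show ?thesis
  proof eventually_elim
    case (elim y)
    then have "g y = y + d" by simp
    with elim show ?case by simp
  qed
qed

lemma right_translation_comp:
  fixes f g :: "real \<Rightarrow> real"
  assumes "\<forall>\<^sub>F y in at_right x. g y - y = d" "\<forall>\<^sub>F z in at_right (x + d). f z - z = c"
  shows "\<forall>\<^sub>F y in at_right x. (f \<circ> g) y - y = d + c"
proof -
  have "\<forall>\<^sub>F y in at_right x. f (y + d) - (y + d) = c"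
    using assms(2) by (subst eventually_at_right_translate)
  with assms(1) show ?thesis
  proof eventually_elim
    case (elim y)
    then have "g y = y + d" by simp
    with elim show ?case by simp
  qed
qed

lemma breaks_comp_subset: "breaks (f \<circ> g) \<subseteq> breaks g \<union> g -` breaks f"
proof
  fix x assume x: "x \<in> breaks (f \<circ> g)"
  show "x \<in> breaks g \<union> g -` breaks f"
  proof (rule ccontr)
    assume "x \<notin> breaks g \<union> g -` breaks f"
    then have "\<forall>\<^sub>F y in at_left x. g y - y = g x - x"
      "\<forall>\<^sub>F z in at_left (x + (g x - x)). f z - z = f (g x) - g x"
      by (auto simp: breaks_def)
    from left_translation_comp[OF this] x show False by (simp add: breaks_def)
  qed
qed

lemma piecewise_translation_comp:
  assumes f: "piecewise_translation f" and g: "piecewise_translation g"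
  shows "piecewise_translation (f \<circ> g)"
  unfolding piecewise_translation_def
proof (intro conjI allI)
  show "bij (f \<circ> g)" using f g by (simp add: piecewise_translation_def bij_comp)
  have "finite (g -` breaks f)"
    using f g by (intro finite_vimageI) (auto simp: piecewise_translation_def bij_is_inj)
  then show "finite (breaks (f \<circ> g))"
    using breaks_comp_subset[of f g] g finite_subset by (auto simp: piecewise_translation_def)
  fix x
  have "\<forall>\<^sub>F y in at_right x. g y - y = g x - x"
      "\<forall>\<^sub>F z in at_right (x + (g x - x)). f z - z = f (g x) - g x"
    using f g by (auto simp: piecewise_translation_def)
  from right_translation_comp[OF this]
  show "\<forall>\<^sub>F y in at_right x. (f \<circ> g) y - y = (f \<circ> g) x - x" by simp
qed

text \<open>Injectivity of \<open>g\<close> makes the preimage of the breaks of \<open>f\<close> no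
  larger than that set. This subadditivity is what bounds the number of breaks linearly in the word
  length.\<close>

lemma card_breaks_comp:
  assumes f: "piecewise_translation f" and g: "piecewise_translation g"
  shows "card (breaks (f \<circ> g)) \<le> card (breaks f) + card (breaks g)"
proof -
  have fin: "finite (breaks f)" "finite (breaks g)" and inj: "inj g"
    using f g by (auto simp: piecewise_translation_def bij_is_inj)
  have "card (breaks (f \<circ> g)) \<le> card (breaks g \<union> g -` breaks f)"
    using fin inj by (intro card_mono breaks_comp_subset) (auto intro: finite_vimageI)
  also have "\<dots> \<le> card (breaks g) + card (g -` breaks f)" by (rule card_Un_le)
  also have "card (g -` breaks f) \<le> card (breaks f)"
    using fin inj by (intro card_inj_on_le[of g]) (auto intro: inj_on_subset)
  finally show ?thesis by simp
qed

text \<open>A translation carries left germs to left germs, so left limits compose like the maps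
  themselves. Thus the left orbit of a point is its orbit under \<open>left_val f\<close>.\<close>

lemma left_val_comp:
  assumes f: "piecewise_translation f" and g: "piecewise_translation g"
  shows "left_val (f \<circ> g) x = left_val f (left_val g x)"
proof -
  have "\<forall>\<^sub>F z in at_left (x + (left_val g x - x)).
      f z - z = left_val f (left_val g x) - left_val g x"
    using piecewise_translation_left[OF f, of "left_val g x"] by simp
  from left_translation_comp[OF piecewise_translation_left[OF g] this]
  have "left_val (f \<circ> g) x = x + ((left_val g x - x) + (left_val f (left_val g x) - left_val g x))"
    by (rule left_val_eqI)
  then show ?thesis by simp
qed

lemma breaks_id [simp]: "breaks id = {}"
  by (simp add: breaks_def)

lemma piecewise_translation_id: "piecewise_translation id"
  by (simp add: piecewise_translation_def)

lemma left_val_id: "left_val id x = x"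
  using left_val_eqI[of id 0 x] by simp

lemma piecewise_translation_funpow:
  assumes "piecewise_translation f" shows "piecewise_translation (f ^^ n)"
  by (induction n) (simp_all only: funpow.simps piecewise_translation_id assms piecewise_translation_comp)

lemma left_val_funpow:
  assumes "piecewise_translation f" shows "left_val (f ^^ n) x = (left_val f ^^ n) x"
proof (induction n)
  case (Suc n)
  then show ?case
    using left_val_comp[OF assms piecewise_translation_funpow[OF assms], of n x]
    by (simp add: comp_def)
qed (simp add: left_val_id[unfolded id_def])

lemma piecewise_translation_inv:
  assumes "piecewise_translation f" shows "piecewise_translation (inv f)"
proof -
  have bij: "bij f" and fin: "finite (breaks f)"
    and rt: "\<And>x. \<forall>\<^sub>F y in at_right x. f y - y = f x - x"
    using assms by (auto simp: piecewise_translation_def)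
  have inv_f: "inv f (f x) = x" for x using bij by (simp add: bij_is_inj)
  have f_inv: "f (inv f x) = x" for x using bij by (simp add: bij_is_surj surj_f_inv_f)
  have inv_eq: "inv f (y + d) - (y + d) = - d" if "f y - y = d" for y d
  proof -
    from that have "y + d = f y" by simp
    with that show ?thesis by (simp add: inv_f)
  qed
  show ?thesis
    unfolding piecewise_translation_def
  proof (intro conjI allI)
    show "bij (inv f)" using bij by (rule bij_imp_bij_inv)
    \<comment> \<open>If \<open>f\<close> is unbroken at \<open>inv f z\<close>, its translation
      there reverses to a translation by \<open>inv f\<close> just left of \<open>z\<close>.\<close>
    have "breaks (inv f) \<subseteq> f ` breaks f"
    proof
      fix z assume z: "z \<in> breaks (inv f)"
      have "inv f z \<in> breaks f"
      proof (rule ccontr)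
        assume "inv f z \<notin> breaks f"
        then have "\<forall>\<^sub>F y in at_left (inv f z). f y - y = z - inv f z"
          by (simp add: breaks_def f_inv)
        then have "\<forall>\<^sub>F y in at_left (inv f z). inv f (y + (z - inv f z)) - (y + (z - inv f z)) = - (z - inv f z)"
          by eventually_elim (rule inv_eq)
        then have "\<forall>\<^sub>F y in at_left z. inv f y - y = - (z - inv f z)"
          by (subst (asm) eventually_at_left_translate) simp
        with z show False by (simp add: breaks_def)
      qed
      then show "z \<in> f ` breaks f" using f_inv[of z] by (metis imageI)
    qed
    then show "finite (breaks (inv f))" using fin finite_subset by blast
    fix z
    have "\<forall>\<^sub>F y in at_right (inv f z). f y - y = z - inv f z"
      using rt[of "inv f z"] by (simp add: f_inv)
    then have "\<forall>\<^sub>F y in at_right (inv f z). inv f (y + (z - inv f z)) - (y + (z - inv f z)) = - (z - inv f z)"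
      by eventually_elim (rule inv_eq)
    then show "\<forall>\<^sub>F y in at_right z. inv f y - y = inv f z - z"
      by (subst (asm) eventually_at_right_translate) simp
  qed
qed

text \<open>The formula is additive over adjacent intervals and holds on short intervals around any
  point, where that point is the only possible break. Bolzano's principle extends it to all
  intervals.\<close>

lemma displacement_eq_sum_jumps:
  assumes f: "piecewise_translation f" and "x \<le> y"
  shows "(f y - y) - (f x - x) = (\<Sum>z\<in>breaks f \<inter> {x<..y}. f z - left_val f z)"
  using \<open>x \<le> y\<close>
proof (induction rule: Bolzano)
  case (trans a b c)
  have "finite (breaks f)" using f by (simp add: piecewise_translation_def)
  moreover have "breaks f \<inter> {a<..c} = (breaks f \<inter> {a<..b}) \<union> (breaks f \<inter> {b<..c})"
    using trans by auto
  moreover have "(breaks f \<inter> {a<..b}) \<inter> (breaks f \<inter> {b<..c}) = {}" by auto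
  ultimately have "(\<Sum>z\<in>breaks f \<inter> {a<..c}. f z - left_val f z) =
      (\<Sum>z\<in>breaks f \<inter> {a<..b}. f z - left_val f z) + (\<Sum>z\<in>breaks f \<inter> {b<..c}. f z - left_val f z)"
    by (simp add: sum.union_disjoint)
  with trans show ?case by simp
next
  case (local x)
  have fin: "finite (breaks f)" using f by (simp add: piecewise_translation_def)
  obtain a where a: "a < x" "\<And>y. a < y \<Longrightarrow> y < x \<Longrightarrow> f y - y = left_val f x - x"
    using piecewise_translation_left[OF f, of x] by (auto simp: eventually_at_left_field)
  obtain a' where a': "a' < x" "{a'<..<x} \<inter> breaks f = {}"
    using finite_avoid_left[OF fin] by blast
  obtain b where b: "b > x" "\<And>y. x < y \<Longrightarrow> y < b \<Longrightarrow> f y - y = f x - x"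
    using f by (force simp: piecewise_translation_def eventually_at_right_field)
  have nb: "z \<notin> breaks f" if "x < z" "z < b" for z
  proof -
    have "\<forall>\<^sub>F y in at_left z. f y - y = f z - z"
      unfolding eventually_at_left[OF that(1)] using b that by (intro exI[of _ x]) auto
    then show ?thesis by (simp add: breaks_def)
  qed
  \<comment> \<open>Within distance \<open>d\<close> of \<open>x\<close> the displacement has one
    constant value on each side, and \<open>x\<close> is the only possible break.\<close>
  define d where "d = Min {x - a, x - a', b - x}"
  have d: "d > 0" "d \<le> x - a" "d \<le> x - a'" "d \<le> b - x"
    using a a' b by (auto simp: d_def)
  show ?case
  proof (intro exI[of _ d] conjI allI impI)
    fix u v assume uv: "u \<le> x \<and> x \<le> v \<and> v - u < d"
    have v: "f v - v = f x - x" using b uv d by (cases "v = x") auto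
    show "(f v - v) - (f u - u) = (\<Sum>z\<in>breaks f \<inter> {u<..v}. f z - left_val f z)"
    proof (cases "u = x")
      case True
      have "breaks f \<inter> {u<..v} = {}" using nb uv d True by auto
      with True v show ?thesis by simp
    next
      case False
      then have u: "f u - u = left_val f x - x" using a uv d by auto
      have "breaks f \<inter> {u<..v} \<subseteq> {x}"
      proof
        fix z assume z: "z \<in> breaks f \<inter> {u<..v}"
        show "z \<in> {x}"
        proof (rule ccontr)
          assume "z \<notin> {x}"
          then consider "z < x" | "x < z" by fastforce
          then show False
          proof cases
            case 1 then have "z \<in> {a'<..<x}" using z uv d by auto
            with a' z show False by blast
          next
            case 2 then show False using z nb[of z] uv d by auto
          qed
        qed
      qed
      then have eq: "breaks f \<inter> {u<..v} = (if x \<in> breaks f then {x} else {})"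
        using uv False by auto
      show ?thesis
        using u v breaks_iff_left_val[OF f, of x] unfolding eq by auto
    qed
  qed (use d in auto)
qed

section \<open>A norm on finitely generated groups of reals\<close>

text \<open>A seminorm over the integers. The absolute value would not do: a finitely generated
  group of reals can be dense, with infinitely many elements of bounded size.
  \<open>exists_proper_norm\<close> supplies an \<open>N\<close> that leaves only finitely
  many.\<close>

locale homogeneous_norm =
  fixes N :: "real \<Rightarrow> real"
  assumes triangle: "N (x + y) \<le> N x + N y"
    and homogeneous: "N (of_int k * x) = \<bar>of_int k\<bar> * N x"
begin

lemma zero: "N 0 = 0"
  using homogeneous[of 0 0] by simp

lemma minus: "N (- x) = N x"
  using homogeneous[of "-1" x] by simp

lemma diff_commute: "N (x - y) = N (y - x)"
  using minus[of "x - y"] by simp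

lemma nonneg: "N x \<ge> 0"
  using triangle[of x "- x"] by (simp add: minus zero)

lemma sum_le: "N (sum h A) \<le> (\<Sum>x\<in>A. N (h x))"
proof (induction A rule: infinite_finite_induct)
  case (insert x A)
  then show ?case using triangle[of "h x" "sum h A"] by simp
qed (simp_all add: zero)

lemma sum_list_le:
  assumes "\<And>x. x \<in> set xs \<Longrightarrow> N x \<le> C"
  shows "N (sum_list xs) \<le> C * length xs"
  using assms
proof (induction xs)
  case (Cons x xs)
  have "N (sum_list (x # xs)) \<le> N x + N (sum_list xs)" using triangle by simp
  also have "\<dots> \<le> C + C * length xs" using Cons by (intro add_mono) auto
  finally show ?case by (simp add: algebra_simps)
qed (simp add: zero)

end

lemma common_denominator:
  assumes "finite (Q :: rat set)"
  shows "\<exists>D::int. D > 0 \<and> (\<forall>q\<in>Q. of_int D * q \<in> \<int>)"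
  using assms
proof (induction rule: finite_induct)
  case (insert q Q)
  then obtain D :: int where D: "D > 0" "\<forall>q\<in>Q. of_int D * q \<in> \<int>" by blast
  obtain a b where ab: "quotient_of q = (a, b)" by fastforce
  have b: "b > 0" "q = of_int a / of_int b"
    using quotient_of_denom_pos[OF ab] quotient_of_div[OF ab] by auto
  have "of_int (D * b) * r \<in> \<int>" if "r \<in> insert q Q" for r
  proof (cases "r = q")
    case True
    have "of_int (D * b) * q = (of_int (D * a) :: rat)" using b by simp
    then show ?thesis using True by (metis Ints_of_int)
  next
    case False
    with that D have "of_int D * r \<in> \<int>" by blast
    with Ints_of_int[of b] have "of_int b * (of_int D * r) \<in> \<int>" by (rule Ints_mult)
    then show ?thesis by (simp add: mult_ac)
  qed
  moreover have "D * b > 0" using D b by simp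
  ultimately show ?case by blast
qed (auto intro: exI[of _ 1])

lemma sum_list_in_subgroup:
  fixes xs :: "'a::monoid_add list"
  assumes "0 \<in> A" "\<And>x y. x \<in> A \<Longrightarrow> y \<in> A \<Longrightarrow> x + y \<in> A" "set xs \<subseteq> A"
  shows "sum_list xs \<in> A"
  using assms(3) by (induction xs) (auto intro: assms)

text \<open>The \<open>\<ell>\<^sup>1\<close>-norm of the coordinates with respect to a basis of the reals over the rationals.
  On a finitely generated group these coordinates have a common denominator.\<close>

lemma exists_proper_norm:
  fixes T :: "real set"
  assumes "finite T"
  shows "\<exists>N. homogeneous_norm N \<and>
    (\<forall>B. finite {v. (\<exists>xs. set xs \<subseteq> T \<and> v = sum_list xs) \<and> N v \<le> B})"
proof -
  interpret rv: vector_space "\<lambda>(q::rat) (x::real). of_rat q * x"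
    by unfold_locales (auto simp: algebra_simps of_rat_add of_rat_mult)
  define H where "H = rv.extend_basis {}"
  define R where "R = rv.representation H"
  have ind: "rv.independent H" and span: "rv.span H = UNIV"
    by (auto simp: H_def rv.independent_extend_basis rv.span_extend_basis rv.independent_empty)
  have R_add: "R (x + y) b = R x b + R y b" for x y b
    by (simp add: R_def rv.representation_add[OF ind] span)
  have R_scale: "R (of_rat q * x) b = q * R x b" for q x b
    by (simp add: R_def rv.representation_scale[OF ind] span)
  have R_0: "R 0 b = 0" for b using R_scale[of 0 0 b] by simp
  have R_fin: "finite {b. R x b \<noteq> 0}" for x
    unfolding R_def by (rule rv.finite_representation)
  \<comment> \<open>Only the finitely many basis elements occurring in some element of
    \<open>T\<close> are measured, so \<open>N\<close> is definite on the group generated by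
    \<open>T\<close> but may vanish elsewhere.\<close>
  define B0 where "B0 = (\<Union>t\<in>T. {b. R t b \<noteq> 0})"
  have B0: "finite B0" using assms R_fin by (simp add: B0_def)
  obtain D :: int where D: "D > 0" "\<And>t b. t \<in> T \<Longrightarrow> b \<in> B0 \<Longrightarrow> of_int D * R t b \<in> \<int>"
    using common_denominator[of "(\<lambda>(t, b). R t b) ` (T \<times> B0)"] assms B0 by auto
  define N where "N x = real_of_rat (\<Sum>b\<in>B0. \<bar>R x b\<bar>)" for x
  have "N (x + y) \<le> N x + N y" for x y
  proof -
    have "(\<Sum>b\<in>B0. \<bar>R (x + y) b\<bar>) \<le> (\<Sum>b\<in>B0. \<bar>R x b\<bar> + \<bar>R y b\<bar>)"
      by (intro sum_mono) (simp add: R_add abs_triangle_ineq)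
    then show ?thesis by (simp add: N_def sum.distrib of_rat_less_eq flip: of_rat_add)
  qed
  moreover have "N (of_int k * x) = \<bar>of_int k\<bar> * N x" for k x
  proof -
    have "R (of_int k * x) b = of_int k * R x b" for b using R_scale[of "of_int k" x b] by simp
    then have "(\<Sum>b\<in>B0. \<bar>R (of_int k * x) b\<bar>) = of_int \<bar>k\<bar> * (\<Sum>b\<in>B0. \<bar>R x b\<bar>)"
      by (simp add: abs_mult sum_distrib_left)
    then show ?thesis unfolding N_def by (simp add: of_rat_mult del: of_int_abs) simp
  qed
  moreover have "finite {v. (\<exists>xs. set xs \<subseteq> T \<and> v = sum_list xs) \<and> N v \<le> B}" for B
  proof -
    \<comment> \<open>The reals supported on \<open>B0\<close> with coordinates in multiples of
      \<open>1 / D\<close>; every sum of elements of \<open>T\<close> is among them.\<close>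
    define \<Gamma> where "\<Gamma> = {v. (\<forall>b\<in>B0. of_int D * R v b \<in> \<int>) \<and> (\<forall>b. b \<notin> B0 \<longrightarrow> R v b = 0)}"
    have \<Gamma>: "sum_list xs \<in> \<Gamma>" if "set xs \<subseteq> T" for xs
    proof (rule sum_list_in_subgroup)
      show "set xs \<subseteq> \<Gamma>" using that D by (auto simp: \<Gamma>_def B0_def)
    qed (auto simp: \<Gamma>_def R_add R_0 distrib_left)
    define K where "K = \<lceil>of_int D * B\<rceil>"
    \<comment> \<open>Such a real is recovered from its coordinates scaled by \<open>D\<close>,
      which are integers bounded by \<open>K\<close> in absolute value.\<close>
    have "{v \<in> \<Gamma>. N v \<le> B} \<subseteq>
      (\<lambda>g. \<Sum>b\<in>B0. real_of_rat (of_int (g b) / of_int D) * b) ` (Pi\<^sub>E B0 (\<lambda>_. {- K..K}))"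
    proof
      fix v assume "v \<in> {v \<in> \<Gamma>. N v \<le> B}"
      then have v: "v \<in> \<Gamma>" "N v \<le> B" by auto
      define g where "g = restrict (\<lambda>b. \<lfloor>of_int D * R v b\<rfloor>) B0"
      have g: "of_int (g b) = of_int D * R v b" if "b \<in> B0" for b
        using v(1) that by (auto simp: g_def \<Gamma>_def elim!: Ints_cases)
      have "\<bar>g b\<bar> \<le> K" if "b \<in> B0" for b
      proof -
        have "\<bar>R v b\<bar> \<le> (\<Sum>b\<in>B0. \<bar>R v b\<bar>)"
          using B0 that by (intro member_le_sum) auto
        then have "real_of_rat \<bar>R v b\<bar> \<le> N v" by (simp add: N_def of_rat_less_eq)
        then have "of_int D * real_of_rat \<bar>R v b\<bar> \<le> of_int D * B" using v D by simp
        also have "of_int D * real_of_rat \<bar>R v b\<bar> = real_of_rat \<bar>of_int (g b)\<bar>"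
          using D g[OF that] by (simp add: abs_mult of_rat_mult)
        also have "\<dots> = of_int \<bar>g b\<bar>" by (metis of_int_abs of_rat_of_int_eq)
        finally show ?thesis unfolding K_def by linarith
      qed
      then have "g \<in> Pi\<^sub>E B0 (\<lambda>_. {- K..K})" by (force simp: g_def)
      moreover have "v = (\<Sum>b\<in>B0. real_of_rat (of_int (g b) / of_int D) * b)"
      proof -
        have "v = (\<Sum>b | R v b \<noteq> 0. of_rat (R v b) * b)"
          unfolding R_def using rv.sum_nonzero_representation_eq[OF ind, of v] span by simp
        also have "\<dots> = (\<Sum>b\<in>B0. of_rat (R v b) * b)"
          using B0 v by (intro sum.mono_neutral_left) (auto simp: \<Gamma>_def)
        also have "\<dots> = (\<Sum>b\<in>B0. real_of_rat (of_int (g b) / of_int D) * b)"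
          using D by (intro sum.cong) (auto simp: g)
        finally show ?thesis .
      qed
      ultimately show "v \<in> (\<lambda>g. \<Sum>b\<in>B0. real_of_rat (of_int (g b) / of_int D) * b) `
        (Pi\<^sub>E B0 (\<lambda>_. {- K..K}))" by blast
    qed
    then have "finite {v \<in> \<Gamma>. N v \<le> B}"
      by (rule finite_subset) (use B0 in \<open>auto intro: finite_PiE\<close>)
    then show ?thesis by (rule rev_finite_subset) (use \<Gamma> in auto)
  qed
  ultimately show ?thesis unfolding homogeneous_norm_def by blast
qed

section \<open>Interval exchange transformations\<close>

lemma is_iet_pieces:
  assumes "is_iet f"
  obtains a c :: "nat \<Rightarrow> real" and k where "\<And>x. x \<in> {0..<1} \<Longrightarrow> \<exists>i<k. x \<in> {a i..<a (Suc i)}"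
    "\<And>i x. i < k \<Longrightarrow> x \<in> {a i..<a (Suc i)} \<Longrightarrow> f x = frac (x + c i)"
proof -
  obtain a :: "nat \<Rightarrow> real" and k where a: "a 0 = 0" "a k = 1"
    "\<forall>i<k. \<exists>c. \<forall>x \<in> {a i..<a (Suc i)}. f x = frac (x + c)"
    using assms by (auto simp: is_iet_def)
  obtain c where c: "\<forall>i<k. \<forall>x \<in> {a i..<a (Suc i)}. f x = frac (x + c i)"
    using a(3) by metis
  have "\<exists>i<k. x \<in> {a i..<a (Suc i)}" if "x \<in> {0..<1}" for x
  proof -
    define j where "j = (LEAST j. x < a j)"
    have ak: "x < a k" using that a by simp
    have j: "x < a j" "\<And>i. i < j \<Longrightarrow> \<not> x < a i" "j \<le> k"
      using ak unfolding j_def by (auto intro: LeastI Least_le dest: not_less_Least)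
    have "j \<noteq> 0" using j(1) a that by (intro notI) simp
    then obtain i where "j = Suc i" by (cases j) auto
    with j show ?thesis by (intro exI[of _ i]) (auto simp: not_less)
  qed
  then show ?thesis using that c by metis
qed

section \<open>Fractional parts as local translations\<close>

lemma frac_translate_right:
  fixes x c :: real
  shows "\<forall>\<^sub>F y in at_right x. frac (y + c) - y = frac (x + c) - x"
proof -
  \<comment> \<open>\<open>1 - frac (x + c)\<close> is the distance from \<open>x + c\<close> to the
    next integer, before which the floor stays constant.\<close>
  have "\<forall>\<^sub>F y in at_right x. x < y \<and> y < x + (1 - frac (x + c))"
    unfolding eventually_at_right_field using frac_lt_1[of "x + c"]
    by (intro exI[of _ "x + (1 - frac (x + c))"]) auto
  then show ?thesis
  proof eventually_elim
    case (elim y)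
    then have "\<lfloor>y + c\<rfloor> = \<lfloor>x + c\<rfloor>"
      unfolding floor_eq_iff frac_def by linarith
    then show ?case by (simp add: frac_def)
  qed
qed

text \<open>At an integer \<open>x + c\<close> the map wraps round, and just to the left the
  displacement is larger by 1. The assumption excludes exactly these points.\<close>

lemma frac_translate_left:
  fixes x c :: real
  assumes "x + c \<notin> \<int>"
  shows "\<forall>\<^sub>F y in at_left x. frac (y + c) - y = frac (x + c) - x"
proof -
  have "frac (x + c) > 0" using assms by simp
  then have "\<forall>\<^sub>F y in at_left x. y < x \<and> x - frac (x + c) < y"
    unfolding eventually_at_left_field
    by (intro exI[of _ "x - frac (x + c)"]) auto
  then show ?thesis
  proof eventually_elim
    case (elim y)
    then have "\<lfloor>y + c\<rfloor> = \<lfloor>x + c\<rfloor>"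
      unfolding floor_eq_iff frac_def by linarith
    then show ?case by (simp add: frac_def)
  qed
qed

lemma is_iet_bij:
  assumes "is_iet f" shows "bij f"
proof -
  have "bij_betw f {0..<1} {0..<1}" using assms by (simp add: is_iet_def)
  moreover have "bij_betw f (- {0..<1}) (- {0..<1})"
    using assms by (subst bij_betw_cong[of _ _ id]) (auto simp: is_iet_def)
  ultimately have "bij_betw f ({0..<1} \<union> - {0..<1}) ({0..<1} \<union> - {0..<1})"
    by (rule bij_betw_combine) simp
  then show ?thesis by simp
qed

lemma floor_in_unit_interval:
  fixes x c :: real
  assumes "x \<in> {0..<1}" shows "\<lfloor>x + c\<rfloor> \<in> {\<lfloor>c\<rfloor>, \<lfloor>c\<rfloor> + 1}"
proof -
  have "\<lfloor>c\<rfloor> \<le> \<lfloor>x + c\<rfloor>" using assms by (intro floor_mono) auto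
  moreover have "\<lfloor>x + c\<rfloor> \<le> \<lfloor>c + 1\<rfloor>" using assms by (intro floor_mono) auto
  ultimately show ?thesis by auto
qed

text \<open>On each piece the displacement is \<open>c i\<close> minus a floor that takes at most
  two values; outside \<open>[0, 1)\<close> it is zero.\<close>

lemma is_iet_finite_displacements:
  assumes "is_iet f" shows "finite (range (\<lambda>x. f x - x))"
proof -
  obtain a c :: "nat \<Rightarrow> real" and k where
    cover: "\<And>x. x \<in> {0..<1} \<Longrightarrow> \<exists>i<k. x \<in> {a i..<a (Suc i)}" and
    eq: "\<And>i x. i < k \<Longrightarrow> x \<in> {a i..<a (Suc i)} \<Longrightarrow> f x = frac (x + c i)"
    using is_iet_pieces[OF assms] by metis
  have "range (\<lambda>x. f x - x) \<subseteq> insert 0 (\<Union>i<k. (\<lambda>m. c i - of_int m) ` {\<lfloor>c i\<rfloor>, \<lfloor>c i\<rfloor> + 1})"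
  proof
    fix v assume "v \<in> range (\<lambda>x. f x - x)"
    then obtain x where x: "v = f x - x" by blast
    show "v \<in> insert 0 (\<Union>i<k. (\<lambda>m. c i - of_int m) ` {\<lfloor>c i\<rfloor>, \<lfloor>c i\<rfloor> + 1})"
    proof (cases "x \<in> {0..<1}")
      case True
      then obtain i where i: "i < k" "x \<in> {a i..<a (Suc i)}" using cover by blast
      then have "v = c i - of_int \<lfloor>x + c i\<rfloor>" using eq[OF i] x by (simp add: frac_def)
      then show ?thesis using i(1) floor_in_unit_interval[OF True, of "c i"] by blast
    next
      case False
      then show ?thesis using assms x by (simp add: is_iet_def)
    qed
  qed
  then show ?thesis by (rule finite_subset) auto
qed

lemma is_iet_piecewise_translation:
  assumes "is_iet f" shows "piecewise_translation f"
  unfolding piecewise_translation_def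
proof (intro conjI allI)
  show "bij f" by (rule is_iet_bij[OF assms])
  have out: "f x = x" if "x \<notin> {0..<1}" for x using that assms by (simp add: is_iet_def)
  obtain a c :: "nat \<Rightarrow> real" and k where
    cover: "\<And>x. x \<in> {0..<1} \<Longrightarrow> \<exists>i<k. x \<in> {a i..<a (Suc i)}" and
    eq: "\<And>i x. i < k \<Longrightarrow> x \<in> {a i..<a (Suc i)} \<Longrightarrow> f x = frac (x + c i)"
    using is_iet_pieces[OF assms] by metis
  show "\<forall>\<^sub>F y in at_right x. f y - y = f x - x" for x
  proof (cases "x \<in> {0..<1}")
    case True
    then obtain i where i: "i < k" "x \<in> {a i..<a (Suc i)}" using cover by blast
    then have "\<forall>\<^sub>F y in at_right x. y \<in> {a i..<a (Suc i)}"
      unfolding eventually_at_right_field by (intro exI[of _ "a (Suc i)"]) auto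
    with frac_translate_right[of "c i" x] show ?thesis
      by eventually_elim (simp add: eq[OF i(1)] eq[OF i])
  next
    case False
    have "\<forall>\<^sub>F y in at_right x. y \<notin> {0..<1}"
      unfolding eventually_at_right_field using False
      by (cases "x < 0") (auto intro: exI[of _ 0] exI[of _ "x + 1"])
    then show ?thesis by eventually_elim (simp add: out[OF False] out)
  qed
  \<comment> \<open>Candidates for breaks: the ends of the unit interval, the left ends of the
    pieces, and the points where \<open>x + c i\<close> is an integer and the map wraps
    round.\<close>
  define F where "F = insert 0 (insert 1 (a ` {..<k} \<union> (\<Union>i<k. (\<lambda>m. of_int m - c i) ` {\<lfloor>c i\<rfloor>, \<lfloor>c i\<rfloor> + 1})))"
  have "breaks f \<subseteq> F"
  proof (rule ccontr)
    assume "\<not> breaks f \<subseteq> F"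
    then obtain x where x: "x \<in> breaks f" "x \<notin> F" by blast
    have "\<forall>\<^sub>F y in at_left x. f y - y = f x - x"
    proof (cases "x \<in> {0..<1}")
      case True
      then obtain i where i: "i < k" "x \<in> {a i..<a (Suc i)}" using cover by blast
      have "x \<noteq> a i" using x(2) i(1) by (auto simp: F_def)
      with i have "\<forall>\<^sub>F y in at_left x. y \<in> {a i..<a (Suc i)}"
        unfolding eventually_at_left_field by (intro exI[of _ "a i"]) auto
      moreover have "x + c i \<notin> \<int>"
      proof
        assume "x + c i \<in> \<int>"
        then have "x = of_int \<lfloor>x + c i\<rfloor> - c i" by (auto elim!: Ints_cases)
        then have "x \<in> F" unfolding F_def using i(1) floor_in_unit_interval[OF True, of "c i"] by blast
        with x(2) show False by simp
      qed
      note frac_translate_left[OF this]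
      ultimately show ?thesis
        by eventually_elim (simp add: eq[OF i(1)] eq[OF i])
    next
      case False
      have "x \<noteq> 0" "x \<noteq> 1" using x by (auto simp: F_def)
      then have "\<forall>\<^sub>F y in at_left x. y \<notin> {0..<1}"
        unfolding eventually_at_left_field using False
        by (cases "x < 0") (auto intro: exI[of _ "x - 1"] exI[of _ 1])
      then show ?thesis by eventually_elim (simp add: out[OF False] out)
    qed
    with x(1) show False by (simp add: breaks_def)
  qed
  then show "finite (breaks f)" by (rule finite_subset) (simp add: F_def)
qed

section \<open>Inverses of the generators\<close>

lemma iet_inv_eq_inv:
  assumes "is_iet f" shows "iet_inv f = inv f"
proof
  fix x
  have "f (iet_inv f x) = x"
  proof (cases "x \<in> {0..<1}")
    case True
    then have "x \<in> f ` {0..<1}" using assms by (simp add: is_iet_def bij_betw_def)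
    with True show ?thesis by (simp add: iet_inv_def f_inv_into_f del: atLeastLessThan_iff)
  next
    case False
    then show ?thesis using assms by (auto simp: iet_inv_def is_iet_def)
  qed
  then show "iet_inv f x = inv f x" using is_iet_bij[OF assms] by (metis bij_inv_eq_iff)
qed

lemma sym_gens_iet:
  assumes "S \<subseteq> IET" "s \<in> sym_gens S"
  shows "piecewise_translation s \<and> finite (range (\<lambda>x. s x - x))"
proof -
  consider "s \<in> S" | g where "g \<in> S" "s = iet_inv g" using assms(2) by (auto simp: sym_gens_def)
  then show ?thesis
  proof cases
    case 1
    then show ?thesis using assms by (auto simp: IET_def is_iet_piecewise_translation is_iet_finite_displacements)
  next
    case 2
    then have g: "is_iet g" using assms by (auto simp: IET_def)
    have "range (\<lambda>x. inv g x - x) \<subseteq> uminus ` range (\<lambda>x. g x - x)"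
    proof
      fix v assume "v \<in> range (\<lambda>x. inv g x - x)"
      then obtain x where "v = inv g x - x" by blast
      then have "v = - (g (inv g x) - inv g x)"
        using is_iet_bij[OF g] by (simp add: bij_is_surj surj_f_inv_f)
      then show "v \<in> uminus ` range (\<lambda>x. g x - x)" by blast
    qed
    then have "finite (range (\<lambda>x. inv g x - x))"
      using is_iet_finite_displacements[OF g] finite_subset by blast
    then show ?thesis
      using 2 g by (simp add: iet_inv_eq_inv is_iet_piecewise_translation piecewise_translation_inv)
  qed
qed

section \<open>Words in the generators\<close>

lemma eval_word_simps [simp]:
  "eval_word [] = id" "eval_word (s # ws) = s \<circ> eval_word ws"
  by (simp_all add: eval_word_def)

lemma eval_word_append: "eval_word (us @ vs) = eval_word us \<circ> eval_word vs"
  by (induction us) (simp_all add: comp_assoc)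

lemma gen_subgroup_funpow:
  assumes "f \<in> gen_subgroup S" shows "f ^^ n \<in> gen_subgroup S"
proof (induction n)
  case 0
  have "[] \<in> words_for S id" by (simp add: words_for_def)
  then show ?case by (auto simp: gen_subgroup_def id_def)
next
  case (Suc n)
  then obtain us vs where "us \<in> words_for S f" "vs \<in> words_for S (f ^^ n)"
    using assms by (auto simp: gen_subgroup_def)
  then have "us @ vs \<in> words_for S (f ^^ Suc n)"
    by (simp add: words_for_def eval_word_append)
  then show ?case unfolding gen_subgroup_def by blast
qed

lemma word_length_attained:
  assumes "g \<in> gen_subgroup S"
  obtains ws where "set ws \<subseteq> sym_gens S" "eval_word ws = g" "length ws = word_length S g"
proof -
  have "\<exists>n. \<exists>ws\<in>words_for S g. length ws = n" using assms by (auto simp: gen_subgroup_def)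
  then have "\<exists>ws\<in>words_for S g. length ws = word_length S g"
    unfolding word_length_def by (rule LeastI_ex)
  then show ?thesis using that by (auto simp: words_for_def)
qed

text \<open>The displacement telescopes over the suffixes of the word: each letter acts at the point
  reached by the letters to its right and contributes one element of \<open>T\<close>.\<close>

lemma eval_word_displacement:
  assumes "\<And>s x. s \<in> set ws \<Longrightarrow> s x - x \<in> T"
  shows "\<exists>xs. set xs \<subseteq> T \<and> length xs = length ws \<and> eval_word ws x - x = sum_list xs"
  using assms
proof (induction ws)
  case (Cons s ws)
  then obtain xs where xs: "set xs \<subseteq> T" "length xs = length ws" "eval_word ws x - x = sum_list xs"
    by auto
  let ?y = "eval_word ws x"
  have "s ?y - ?y \<in> T" using Cons by simp
  moreover have "eval_word (s # ws) x - x = (s ?y - ?y) + sum_list xs" using xs by simp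
  ultimately show ?case using xs by (intro exI[of _ "(s ?y - ?y) # xs"]) auto
qed simp

lemma piecewise_translation_eval_word:
  assumes "\<And>s. s \<in> set ws \<Longrightarrow> piecewise_translation s"
  shows "piecewise_translation (eval_word ws)"
  using assms by (induction ws) (simp_all add: piecewise_translation_id piecewise_translation_comp del: comp_apply)

lemma card_breaks_eval_word:
  assumes "\<And>s. s \<in> set ws \<Longrightarrow> piecewise_translation s \<and> card (breaks s) \<le> C"
  shows "card (breaks (eval_word ws)) \<le> C * length ws"
  using assms
proof (induction ws)
  case (Cons s ws)
  have "card (breaks (eval_word (s # ws))) \<le> card (breaks s) + card (breaks (eval_word ws))"
    using Cons.prems by (simp add: card_breaks_comp piecewise_translation_eval_word)
  also have "\<dots> \<le> C + C * length ws" using Cons by (intro add_mono) auto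
  finally show ?case by (simp add: comp_def)
qed simp

section \<open>Breaks of iterates\<close>

lemma funpow_add_apply: "(f ^^ (m + n)) x = (f ^^ m) ((f ^^ n) x)"
  by (simp add: funpow_add)

lemma funpow_eq_imp_periodic:
  assumes "inj f" "(f ^^ a) x = (f ^^ b) x" "a < b"
  shows "(f ^^ (b - a)) x = x"
proof -
  have "(f ^^ a) ((f ^^ (b - a)) x) = (f ^^ a) x"
    using assms by (simp flip: funpow_add_apply)
  then show ?thesis using inj_fn[OF assms(1), of a] by (simp add: inj_eq)
qed

lemma left_val_funpow_agree:
  assumes "piecewise_translation f" "\<And>i. i < j \<Longrightarrow> (f ^^ i) x \<notin> breaks f"
  shows "(left_val f ^^ j) x = (f ^^ j) x"
  using assms(2)
proof (induction j)
  case (Suc j)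
  then have "(left_val f ^^ j) x = (f ^^ j) x" "(f ^^ j) x \<notin> breaks f" by auto
  then show ?case using breaks_iff_left_val[OF assms(1)] by simp
qed simp

text \<open>A periodic break violates the condition with \<open>x = p\<close>, so for injective
  \<open>f\<close> the forward orbit of an initial break never repeats.\<close>

definition initial_breaks :: "(real \<Rightarrow> real) \<Rightarrow> real set" where
  "initial_breaks f = {p \<in> breaks f. \<forall>j\<ge>1. \<forall>x. (f ^^ j) x = p \<longrightarrow> x \<notin> breaks f}"

text \<open>The set \<open>W\<close> of the overview: points strictly after one break and at or
  before another, possibly the same, along an orbit. Every break that is not initial belongs to it,
  with \<open>i = 0\<close>.\<close>

definition inner_breaks :: "(real \<Rightarrow> real) \<Rightarrow> real set" where
  "inner_breaks f = {x. (\<exists>i. (f ^^ i) x \<in> breaks f) \<and> (\<exists>j\<ge>1. \<exists>q\<in>breaks f. (f ^^ j) q = x)}"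

definition split_times :: "(real \<Rightarrow> real) \<Rightarrow> real \<Rightarrow> nat set" where
  "split_times f p = {k. (left_val f ^^ k) p \<noteq> (f ^^ k) p}"

text \<open>If the left and right orbits of an initial break \<open>p\<close> never merge, then \<open>f ^^ n\<close> breaks
  at all but boundedly many of the \<open>n\<close> preimages of \<open>p\<close> under \<open>f ^^ j\<close>, \<open>j < n\<close>.\<close>

lemma finite_split_times:
  assumes f: "piecewise_translation f" and p: "p \<in> initial_breaks f"
    and few: "\<And>n\<^sub>0. \<exists>n\<ge>n\<^sub>0. 2 * card (breaks (f ^^ n)) \<le> n"
  shows "finite (split_times f p)"
proof -
  have bij: "bij f" and fin: "finite (breaks f)" using f by (auto simp: piecewise_translation_def)
  have inj: "inj f" using bij by (rule bij_is_inj)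
  have pP: "p \<in> breaks f" and before: "\<And>j x. j \<ge> 1 \<Longrightarrow> (f ^^ j) x = p \<Longrightarrow> x \<notin> breaks f"
    using p by (auto simp: initial_breaks_def)
  have aper: "(f ^^ j) p \<noteq> p" if "j \<ge> 1" for j using before[OF that] pP by blast
  have injp: "inj (\<lambda>k. (f ^^ k) p)"
  proof (rule linorder_injI)
    fix a b :: nat assume "a < b"
    with aper[of "b - a"] show "(f ^^ a) p \<noteq> (f ^^ b) p"
      using funpow_eq_imp_periodic[OF inj, of a p b] by auto
  qed
  \<comment> \<open>The orbit of \<open>p\<close> never repeats, so it meets the finite set of
    breaks only finitely often; from time \<open>K\<close> on it avoids them.\<close>
  have "finite ((\<lambda>k. (f ^^ k) p) -` breaks f)" by (rule finite_vimageI[OF fin injp])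
  then obtain K where K: "\<And>k. k \<ge> K \<Longrightarrow> (f ^^ k) p \<notin> breaks f"
    unfolding finite_nat_set_iff_bounded by (metis linorder_not_less vimageI)
  show ?thesis
  proof (cases "\<exists>k\<ge>K. k \<notin> split_times f p")
    case True
    then obtain k where k: "k \<ge> K" "(left_val f ^^ k) p = (f ^^ k) p" by (auto simp: split_times_def)
    \<comment> \<open>After time \<open>K\<close> a merger is permanent, since only a break can
      separate the two orbits.\<close>
    have "(left_val f ^^ l) p = (f ^^ l) p" if "l \<ge> k" for l
      using that
    proof (induction l rule: dec_induct)
      case (step l)
      then show ?case using K[of l] k(1) breaks_iff_left_val[OF f, of "(f ^^ l) p"] by simp
    qed (rule k)
    then have "split_times f p \<subseteq> {..<k}" 
      unfolding split_times_def by (metis (mono_tags, lifting) lessThan_iff linorder_not_less mem_Collect_eq subsetI)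
    then show ?thesis by (rule finite_subset) simp
  next
    case False
    then have split: "(left_val f ^^ k) p \<noteq> (f ^^ k) p" if "k \<ge> K" for k
      using that by (auto simp: split_times_def)
    \<comment> \<open>\<open>n \<ge> 2 * K\<close> makes the \<open>n - K + 1\<close> breaks found
      below more than \<open>n / 2\<close>.\<close>
    obtain n where n: "n \<ge> 2 * K" "2 * card (breaks (f ^^ n)) \<le> n" using few by blast
    define x where "x j = inv (f ^^ j) p" for j
    have x: "(f ^^ j) (x j) = p" for j
      unfolding x_def using bij_fn[OF bij, of j] by (simp add: bij_is_surj surj_f_inv_f)
    have "inj_on x {..n - K}"
    proof (rule inj_onI, rule ccontr)
      have "x i \<noteq> x j" if "i < j" for i j
      proof
        assume "x i = x j"
        then have "(f ^^ i) (x i) = (f ^^ j) (x i)" using x by metis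
        then have "(f ^^ (j - i)) (x i) = x i" by (rule funpow_eq_imp_periodic[OF inj _ that])
        then have "(f ^^ i) ((f ^^ (j - i)) (x i)) = p" using x by simp
        then have "(f ^^ (j - i)) p = p"
          using x[of i] by (metis add.commute funpow_add_apply)
        with aper[of "j - i"] that show False by (simp add: Suc_le_eq)
      qed
      then show "False" if "x i = x j" "i \<noteq> j" for i j
        using that by (metis linorder_neqE_nat)
    qed
    moreover have "x ` {..n - K} \<subseteq> breaks (f ^^ n)"
    proof
      fix z assume "z \<in> x ` {..n - K}"
      then obtain j where j: "j \<le> n - K" "z = x j" by auto
      \<comment> \<open>No break precedes \<open>p\<close> on its orbit, so the left and right
        orbits of \<open>z\<close> reach \<open>p\<close> together; the remaining time
        \<open>n - j\<close> is at least \<open>K\<close>, so they end up apart.\<close>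
      have "(f ^^ i) z \<notin> breaks f" if "i < j" for i
        using that before[of "j - i" "(f ^^ i) z"] x[of j] j
        by (simp flip: funpow_add_apply)
      then have "(left_val f ^^ j) z = p"
        using left_val_funpow_agree[OF f, of j z] x j by simp
      moreover have nj: "n = (n - j) + j" using j n by simp
      ultimately have "(left_val f ^^ n) z = (left_val f ^^ (n - j)) p" "(f ^^ n) z = (f ^^ (n - j)) p"
        using x[of j] j(2) funpow_add_apply[of "n - j" j] by metis+
      then show "z \<in> breaks (f ^^ n)"
        using split[of "n - j"] j n
        by (simp add: breaks_iff_left_val piecewise_translation_funpow left_val_funpow f)
    qed
    moreover have "finite (breaks (f ^^ n))"
      using piecewise_translation_funpow[OF f] by (simp add: piecewise_translation_def)
    ultimately have "card {..n - K} \<le> card (breaks (f ^^ n))" by (rule card_inj_on_le)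
    with n have False by simp
    then show ?thesis ..
  qed
qed

text \<open>For breaks \<open>p\<close> and \<open>q\<close> the orbit segments from
  \<open>p\<close> to \<open>q\<close> contain finitely many points: either \<open>p\<close> is
  periodic and its orbit is finite, or the travel time from \<open>p\<close> to \<open>q\<close> is
  unique.\<close>

lemma finite_inner_breaks:
  assumes f: "piecewise_translation f"
  shows "finite (inner_breaks f)"
proof -
  have inj: "inj f" and fin: "finite (breaks f)"
    using f by (auto simp: piecewise_translation_def bij_is_inj)
  define A where "A p q = {(f ^^ j) p | i j. (f ^^ (i + j)) p = q}" for p q
  have "finite (A p q)" for p q
  proof (cases "\<exists>m\<ge>1. (f ^^ m) p = p")
    case True
    then obtain m where m: "m \<ge> 1" "(f ^^ m) p = p" by blast
    have "A p q \<subseteq> (\<lambda>j. (f ^^ j) p) ` {..<m}"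
    proof
      fix x assume "x \<in> A p q"
      then obtain j where "x = (f ^^ j) p" by (auto simp: A_def)
      then have "x = (f ^^ (j mod m)) p" using funpow_mod_eq[OF m(2)] by simp
      then show "x \<in> (\<lambda>j. (f ^^ j) p) ` {..<m}" using m(1) by auto
    qed
    then show ?thesis by (rule finite_subset) simp
  next
    case False
    have uniq: "a = b" if "(f ^^ a) p = (f ^^ b) p" for a b
    proof (rule ccontr)
      assume "a \<noteq> b"
      then obtain c d where "c < d" "(f ^^ c) p = (f ^^ d) p"
        using \<open>(f ^^ a) p = (f ^^ b) p\<close> by (metis linorder_neqE_nat)
      then have "(f ^^ (d - c)) p = p" "d - c \<ge> 1"
        using funpow_eq_imp_periodic[OF inj] by auto
      with False show False by blast
    qed
    show ?thesis
    proof (cases "\<exists>m. (f ^^ m) p = q")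
      case True
      then obtain m where m: "(f ^^ m) p = q" by blast
      have "A p q \<subseteq> (\<lambda>j. (f ^^ j) p) ` {..m}"
        using uniq m by (fastforce simp: A_def)
      then show ?thesis by (rule finite_subset) simp
    next
      case False
      then have "A p q = {}" by (auto simp: A_def)
      then show ?thesis by simp
    qed
  qed
  then have "finite (\<Union>p\<in>breaks f. \<Union>q\<in>breaks f. A p q)" using fin by blast
  moreover have "inner_breaks f \<subseteq> (\<Union>p\<in>breaks f. \<Union>q\<in>breaks f. A p q)"
  proof
    fix x assume "x \<in> inner_breaks f"
    then obtain i j p where "(f ^^ i) x \<in> breaks f" "p \<in> breaks f" "(f ^^ j) p = x"
      by (auto simp: inner_breaks_def)
    then show "x \<in> (\<Union>p\<in>breaks f. \<Union>q\<in>breaks f. A p q)"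
      unfolding A_def by (auto simp: funpow_add_apply intro!: bexI)
  qed
  ultimately show ?thesis by (rule rev_finite_subset)
qed

text \<open>For a break \<open>x\<close> of \<open>f ^^ n\<close> outside the inner set, the first
  break \<open>p\<close> on its orbit is initial. The left and right orbits agree up to
  \<open>p\<close>, so the jump at \<open>x\<close> is their gap at a split time \<open>k\<close> of
  \<open>p\<close>. For given \<open>n\<close> the pair \<open>(p, k)\<close> determines
  \<open>x\<close>, and there are finitely many pairs, independently of \<open>n\<close>.\<close>

lemma bounded_outer_jumps:
  assumes f: "piecewise_translation f"
    and split: "\<And>p. p \<in> initial_breaks f \<Longrightarrow> finite (split_times f p)"
  obtains M :: nat and V :: "real set" where "finite V"
    "\<And>n. card (breaks (f ^^ n) - inner_breaks f) \<le> M"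
    "\<And>n x. x \<in> breaks (f ^^ n) - inner_breaks f \<Longrightarrow> (f ^^ n) x - left_val (f ^^ n) x \<in> V"
proof -
  have bij: "bij f" and fin: "finite (breaks f)"
    using f by (auto simp: piecewise_translation_def)
  define G where "G = Sigma (initial_breaks f) (split_times f)"
  define V where "V = (\<lambda>(p, k). (f ^^ k) p - (left_val f ^^ k) p) ` G"
  have G: "finite G"
    unfolding G_def using split fin by (intro finite_SigmaI) (auto simp: initial_breaks_def)
  have key: "\<exists>(p, k)\<in>G. x = inv (f ^^ (n - k)) p \<and>
      (f ^^ n) x - left_val (f ^^ n) x = (f ^^ k) p - (left_val f ^^ k) p"
    if x: "x \<in> breaks (f ^^ n)" "x \<notin> inner_breaks f" for x n
  proof -
    have ne: "(left_val f ^^ n) x \<noteq> (f ^^ n) x"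
      using x(1) by (simp add: breaks_iff_left_val piecewise_translation_funpow left_val_funpow f)
    then obtain i0 where i0: "i0 < n" "(f ^^ i0) x \<in> breaks f"
      using left_val_funpow_agree[OF f, of n x] by blast
    define i where "i = (LEAST i. (f ^^ i) x \<in> breaks f)"
    have i: "(f ^^ i) x \<in> breaks f" "i < n"
      using i0 LeastI[of "\<lambda>i. (f ^^ i) x \<in> breaks f" i0] Least_le[of "\<lambda>i. (f ^^ i) x \<in> breaks f" i0]
      by (auto simp: i_def)
    have below: "(f ^^ l) x \<notin> breaks f" if "l < i" for l
      using not_less_Least that unfolding i_def by blast
    define p k where "p = (f ^^ i) x" and "k = n - i"
    have p: "p \<in> initial_breaks f"
      unfolding initial_breaks_def
    proof (intro CollectI conjI allI impI)
      show "p \<in> breaks f" using i by (simp add: p_def)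
      fix j y assume j: "1 \<le> j" "(f ^^ j) y = p"
      \<comment> \<open>An earlier break \<open>y\<close> at or after \<open>x\<close> would
        contradict the choice of \<open>i\<close> as least; one strictly before \<open>x\<close>
        would make \<open>x\<close> inner.\<close>
      show "y \<notin> breaks f"
      proof (cases "j \<le> i")
        case True
        then have "(f ^^ j) ((f ^^ (i - j)) x) = (f ^^ j) y"
          using j by (simp add: p_def flip: funpow_add_apply)
        then have "y = (f ^^ (i - j)) x"
          using inj_fn[OF bij_is_inj[OF bij], of j] by (simp add: inj_eq)
        with below[of "i - j"] True j show ?thesis by simp
      next
        case False
        then have "(f ^^ i) ((f ^^ (j - i)) y) = (f ^^ i) x"
          using j by (simp add: p_def flip: funpow_add_apply)
        then have "(f ^^ (j - i)) y = x"
          using inj_fn[OF bij_is_inj[OF bij], of i] by (simp add: inj_eq)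
        moreover have "j - i \<ge> 1" using False by simp
        ultimately show ?thesis using x(2) i(1) unfolding inner_breaks_def by blast
      qed
    qed
    have n: "n = k + i" using i by (simp add: k_def)
    have "(left_val f ^^ i) x = p" using left_val_funpow_agree[OF f below] by (simp add: p_def)
    then have l: "(left_val f ^^ n) x = (left_val f ^^ k) p" by (simp add: n funpow_add_apply)
    have r: "(f ^^ n) x = (f ^^ k) p" by (simp add: n funpow_add_apply p_def)
    have "(p, k) \<in> G" using p ne l r by (simp add: G_def split_times_def)
    moreover have "x = inv (f ^^ (n - k)) p"
      using inj_fn[OF bij_is_inj[OF bij], of i] by (simp add: n p_def)
    ultimately show ?thesis using l r by (auto simp: left_val_funpow[OF f])
  qed
  show ?thesis
  proof
    show "finite V" using G by (simp add: V_def)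
    show "card (breaks (f ^^ n) - inner_breaks f) \<le> card G" for n
    proof -
      have "breaks (f ^^ n) - inner_breaks f \<subseteq> (\<lambda>(p, k). inv (f ^^ (n - k)) p) ` G"
        using key by fastforce
      then show ?thesis using G by (rule surj_card_le[rotated])
    qed
    show "(f ^^ n) x - left_val (f ^^ n) x \<in> V" if "x \<in> breaks (f ^^ n) - inner_breaks f" for n x
      using key[of x n] that by (force simp: V_def)
  qed
qed

section \<open>Growth of displacements\<close>

context homogeneous_norm
begin

text \<open>Equal intersections mean that no inner point separates \<open>x\<close> from
  \<open>y\<close>. The displacements then differ by a sum of at most \<open>M\<close> outer jumps,
  all from the finite set \<open>V\<close>.\<close>

lemma displacement_bounded_on_cells:
  assumes f: "piecewise_translation f"
    and split: "\<And>p. p \<in> initial_breaks f \<Longrightarrow> finite (split_times f p)"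
  obtains B where "\<And>n x y. inner_breaks f \<inter> {..x} = inner_breaks f \<inter> {..y} \<Longrightarrow>
    N (((f ^^ n) y - y) - ((f ^^ n) x - x)) \<le> B"
proof -
  obtain M :: nat and V :: "real set" where V: "finite V"
    and M: "\<And>n. card (breaks (f ^^ n) - inner_breaks f) \<le> M"
    and jump: "\<And>n x. x \<in> breaks (f ^^ n) - inner_breaks f \<Longrightarrow> (f ^^ n) x - left_val (f ^^ n) x \<in> V"
    using bounded_outer_jumps[OF f split] by metis
  define b where "b = (\<Sum>v\<in>V. N v)"
  have b: "N v \<le> b" if "v \<in> V" for v
    unfolding b_def using V that nonneg by (intro member_le_sum) auto
  have b0: "b \<ge> 0" unfolding b_def by (intro sum_nonneg nonneg)
  have le: "N (((f ^^ n) y - y) - ((f ^^ n) x - x)) \<le> M * b"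
    if "x \<le> y" and W: "inner_breaks f \<inter> {..x} = inner_breaks f \<inter> {..y}" for n x y
  proof -
    let ?J = "breaks (f ^^ n) \<inter> {x<..y}"
    have fin: "finite (breaks (f ^^ n))"
      using piecewise_translation_funpow[OF f] by (simp add: piecewise_translation_def)
    have sub: "?J \<subseteq> breaks (f ^^ n) - inner_breaks f" using W by force
    have "N (((f ^^ n) y - y) - ((f ^^ n) x - x)) = N (\<Sum>z\<in>?J. (f ^^ n) z - left_val (f ^^ n) z)"
      using displacement_eq_sum_jumps[OF piecewise_translation_funpow[OF f] \<open>x \<le> y\<close>] by simp
    also have "\<dots> \<le> (\<Sum>z\<in>?J. N ((f ^^ n) z - left_val (f ^^ n) z))" by (rule sum_le)
    also have "\<dots> \<le> card ?J * b"
      using sub by (intro sum_bounded_above b jump) auto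
    also have "\<dots> \<le> M * b"
      using card_mono[OF _ sub] fin M[of n] b0 by (intro mult_right_mono) auto
    finally show ?thesis .
  qed
  show ?thesis
  proof
    fix n x y assume W: "inner_breaks f \<inter> {..x} = inner_breaks f \<inter> {..y}"
    show "N (((f ^^ n) y - y) - ((f ^^ n) x - x)) \<le> M * b"
    proof (cases "x \<le> y")
      case True
      then show ?thesis using W by (rule le)
    next
      case False
      then have "N (((f ^^ n) x - x) - ((f ^^ n) y - y)) \<le> M * b"
        using W by (intro le) auto
      then show ?thesis by (subst diff_commute)
    qed
  qed
qed

text \<open>Over \<open>k * m\<close> steps the displacement is \<open>k\<close> times that over
  \<open>m\<close> steps, up to an error of norm at most \<open>k * B\<close>. If the latter had
  norm above \<open>B\<close>, growth would be at least linear, against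
  \<open>small\<close>.\<close>

lemma return_displacement_le:
  assumes cell: "\<And>n. N (((f ^^ n) ((f ^^ m) x) - (f ^^ m) x) - ((f ^^ n) x - x)) \<le> B"
    and step: "\<And>y. N (f y - y) \<le> A"
    and small: "\<And>\<epsilon> n\<^sub>0. \<epsilon> > 0 \<Longrightarrow> \<exists>n\<ge>n\<^sub>0. N ((f ^^ n) x - x) \<le> \<epsilon> * real n"
    and "m \<ge> 1"
  shows "N ((f ^^ m) x - x) \<le> B"
proof (rule ccontr)
  assume large: "\<not> N ((f ^^ m) x - x) \<le> B"
  define v where "v = (f ^^ m) x - x"
  define \<eta> where "\<eta> = N v - B"
  have \<eta>: "\<eta> > 0" using large by (simp add: \<eta>_def v_def)
  have A: "A \<ge> 0" using step[of 0] nonneg[of "f 0 - 0"] by simp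
  have iter: "N ((f ^^ r) y - y) \<le> A * r" for r y
  proof (induction r)
    case (Suc r)
    have "N ((f ^^ Suc r) y - y) \<le> N (f ((f ^^ r) y) - (f ^^ r) y) + N ((f ^^ r) y - y)"
      using triangle[of "f ((f ^^ r) y) - (f ^^ r) y" "(f ^^ r) y - y"] by simp
    also have "\<dots> \<le> A + A * r" using Suc step by (intro add_mono) auto
    finally show ?case by (simp add: algebra_simps)
  qed (simp add: zero)
  have blocks: "N (((f ^^ (k * m)) x - x) - real k * v) \<le> real k * B" for k
  proof (induction k)
    case (Suc k)
    \<comment> \<open>\<open>?a\<close> compares \<open>k * m\<close> steps begun at
      \<open>(f ^^ m) x\<close> with as many begun at \<open>x\<close>. Splitting off the first
      block in this way requires only this one return to be comparable with
      \<open>x\<close>.\<close>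
    let ?a = "((f ^^ (k * m)) ((f ^^ m) x) - (f ^^ m) x) - ((f ^^ (k * m)) x - x)"
    let ?b = "((f ^^ (k * m)) x - x) - real k * v"
    have "(f ^^ (Suc k * m)) x = (f ^^ (k * m)) ((f ^^ m) x)"
      by (metis funpow_add_apply add.commute mult_Suc)
    then have "((f ^^ (Suc k * m)) x - x) - real (Suc k) * v = ?a + ?b"
      by (simp add: v_def algebra_simps)
    then have "N (((f ^^ (Suc k * m)) x - x) - real (Suc k) * v) \<le> N ?a + N ?b"
      using triangle by metis
    also have "\<dots> \<le> B + real k * B" using cell Suc by (intro add_mono) auto
    finally show ?case by (simp add: algebra_simps)
  qed (simp add: zero)
  \<comment> \<open>Half the linear rate of \<open>\<eta>\<close> per \<open>m\<close>
    steps.\<close>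
  define \<epsilon> where "\<epsilon> = \<eta> / (2 * m)"
  have \<epsilon>: "\<epsilon> > 0" using \<eta> \<open>m \<ge> 1\<close> by (simp add: \<epsilon>_def)
  \<comment> \<open>The bound that the final estimate places on the number \<open>k\<close> of full
    blocks.\<close>
  obtain K :: nat where K: "real K > 1 + 2 * (m * A) / \<eta>" using reals_Archimedean2 by blast
  obtain n where n: "n \<ge> K * m" "N ((f ^^ n) x - x) \<le> \<epsilon> * real n" using small[OF \<epsilon>] by blast
  define k r where "k = n div m" and "r = n mod m"
  have kr: "n = r + k * m" "r < m" using \<open>m \<ge> 1\<close> by (auto simp: k_def r_def)
  have "K \<le> k" using n(1) \<open>m \<ge> 1\<close> unfolding k_def by (simp add: less_eq_div_iff_mult_less_eq)
  let ?y = "(f ^^ (k * m)) x"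
  have "real k * N v = N (real k * v)" using homogeneous[of "int k" v] by simp
  also have "\<dots> \<le> N (?y - x) + N (real k * v - (?y - x))"
    using triangle[of "?y - x" "real k * v - (?y - x)"] by simp
  also have "N (real k * v - (?y - x)) \<le> real k * B" using blocks[of k] diff_commute by metis
  also have "N (?y - x) \<le> N ((f ^^ n) x - x) + N (?y - (f ^^ n) x)"
    using triangle[of "(f ^^ n) x - x" "?y - (f ^^ n) x"] by simp
  also have "N (?y - (f ^^ n) x) = N ((f ^^ r) ?y - ?y)"
    using diff_commute by (simp add: kr(1) funpow_add_apply)
  also have "N ((f ^^ r) ?y - ?y) \<le> A * r" by (rule iter)
  also have "A * r \<le> A * m" using A kr by (intro mult_left_mono) auto
  finally have "real k * \<eta> \<le> \<epsilon> * n + m * A"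
    using n(2) by (simp add: \<eta>_def algebra_simps)
  also have "\<epsilon> * n \<le> \<epsilon> * (m * (k + 1))"
  proof -
    have "n \<le> m * (k + 1)" using kr by (simp add: algebra_simps)
    then have "real n \<le> real m * (k + 1)" by (metis of_nat_le_iff of_nat_mult of_nat_1 of_nat_add)
    then show ?thesis using \<epsilon> by (intro mult_left_mono) (auto simp: algebra_simps)
  qed
  also have "\<epsilon> * (m * (k + 1)) = \<eta> * (k + 1) / 2" using \<open>m \<ge> 1\<close> by (simp add: \<epsilon>_def field_simps)
  finally have "real k * \<eta> \<le> \<eta> + 2 * (m * A)" by (simp add: field_simps)
  then have "real k \<le> 1 + 2 * (m * A) / \<eta>" using \<eta> by (simp add: field_simps)
  with K \<open>K \<le> k\<close> show False by simp
qed

end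

section \<open>Pigeonhole on orbits\<close>

lemma finite_order_if_bounded_orbits:
  assumes "inj f" and L: "\<And>x. \<not> inj_on (\<lambda>m. (f ^^ m) x) {..L}"
  shows "f ^^ fact L = id"
proof
  fix x
  obtain i j where "i \<le> L" "j \<le> L" "i \<noteq> j" "(f ^^ i) x = (f ^^ j) x"
    using L[of x] by (auto simp: inj_on_def)
  then obtain a b where ab: "a < b" "b \<le> L" "(f ^^ a) x = (f ^^ b) x"
    by (metis linorder_neqE_nat)
  then have per: "(f ^^ (b - a)) x = x" using funpow_eq_imp_periodic[OF assms(1)] by blast
  \<comment> \<open>All periods are at most \<open>L\<close> and so divide \<open>fact L\<close>;
    one power serves every point.\<close>
  have "b - a dvd fact L" using ab by (intro dvd_fact) auto
  then have "(f ^^ (fact L)) x = x"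
    using funpow_mod_eq[OF per, of "fact L"] by simp
  then show "(f ^^ fact L) x = id x" by simp
qed

text \<open>Each term is determined by its cell and its difference from the first term in that cell.
  The index set has one element more than there are such pairs.\<close>

lemma not_inj_on_if_finite_cell_differences:
  fixes x :: "nat \<Rightarrow> 'a::ab_group_add"
  assumes fin: "finite V" "finite (range cell)"
    and V: "\<And>i j. i \<le> j \<Longrightarrow> cell (x i) = cell (x j) \<Longrightarrow> x j - x i \<in> V"
  shows "\<not> inj_on x {..card V * card (range cell)}"
proof
  let ?I = "{..card V * card (range cell)}"
  assume inj: "inj_on x ?I"
  define first where "first c = (LEAST i. cell (x i) = c)" for c
  have first: "first (cell (x j)) \<le> j" "cell (x (first (cell (x j)))) = cell (x j)" for j
    unfolding first_def by (auto intro: Least_le LeastI)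
  have "x ` ?I \<subseteq> (\<lambda>(v, c). x (first c) + v) ` (V \<times> range cell)"
  proof
    fix y assume "y \<in> x ` ?I"
    then obtain j where j: "y = x j" by blast
    let ?c = "cell (x j)"
    have "x j - x (first ?c) \<in> V" using V first by blast
    moreover have "y = x (first ?c) + (x j - x (first ?c))" using j by simp
    ultimately show "y \<in> (\<lambda>(v, c). x (first c) + v) ` (V \<times> range cell)"
      by (intro image_eqI[of _ _ "(x j - x (first ?c), ?c)"]) auto
  qed
  then have "card (x ` ?I) \<le> card (V \<times> range cell)"
    using fin by (intro surj_card_le) auto
  then show False using card_image[OF inj] by (simp add: card_cartesian_product)
qed

section \<open>Sublinear word length forces finite order\<close>

lemma frequently_small_of_liminf_zero:
  fixes l :: "nat \<Rightarrow> nat"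
  assumes "liminf (\<lambda>n. ereal (real (l n) / real n)) = 0" "\<epsilon> > 0"
  shows "\<exists>n\<ge>n\<^sub>0. real (l n) \<le> \<epsilon> * real n"
proof (rule ccontr)
  assume "\<not> ?thesis"
  then have *: "\<epsilon> * real n < real (l n)" if "n \<ge> n\<^sub>0" for n using that by force
  \<comment> \<open>Starting at \<open>Suc n\<^sub>0\<close> keeps \<open>n\<close> positive, away
    from the default value of division by zero.\<close>
  have "\<forall>\<^sub>F n in sequentially. ereal \<epsilon> \<le> ereal (real (l n) / real n)"
    using eventually_ge_at_top[of "Suc n\<^sub>0"]
  proof eventually_elim
    case (elim n)
    then show ?case using *[of n] by (simp add: field_simps)
  qed
  then have "ereal \<epsilon> \<le> liminf (\<lambda>n. ereal (real (l n) / real n))" by (rule Liminf_bounded)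
  with assms show False by simp
qed

theorem theorem1p3:
  shows "\<forall>f \<in> IET. \<not> distortion_in_IET f"
proof (intro ballI notI)
  fix f assume "f \<in> IET" and "distortion_in_IET f"
  then obtain S where S: "finite S" "S \<subseteq> IET" and gen: "f \<in> gen_subgroup S"
    and inf: "infinite_order f"
    and lim: "liminf (\<lambda>n::nat. ereal (real (word_length S (f ^^ n)) / real n)) = 0"
    by (auto simp: distortion_in_IET_def distortion_fg_def)
  have f: "piecewise_translation f"
    using \<open>f \<in> IET\<close> by (simp add: IET_def is_iet_piecewise_translation)
  let ?G = "sym_gens S"
  let ?l = "\<lambda>n. word_length S (f ^^ n)"
  have fin_G: "finite ?G" using S by (simp add: sym_gens_def)
  have G: "piecewise_translation s" "finite (range (\<lambda>x. s x - x))" if "s \<in> ?G" for s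
    using sym_gens_iet[OF S(2) that] by auto
  define T where "T = (\<Union>s\<in>?G. range (\<lambda>x. s x - x))"
  have T: "finite T" using fin_G G by (simp add: T_def)
  obtain N where N: "homogeneous_norm N"
    and proper: "\<And>B. finite {v. (\<exists>xs. set xs \<subseteq> T \<and> v = sum_list xs) \<and> N v \<le> B}"
    using exists_proper_norm[OF T] by blast
  interpret homogeneous_norm N by (rule N)
  define A where "A = (\<Sum>t\<in>T. N t)"
  have A: "N t \<le> A" if "t \<in> T" for t
    unfolding A_def using T that nonneg by (intro member_le_sum) auto
  have A0: "A \<ge> 0" unfolding A_def by (intro sum_nonneg nonneg)
  define C where "C = (\<Sum>s\<in>?G. card (breaks s))"
  have C: "card (breaks s) \<le> C" if "s \<in> ?G" for s
    unfolding C_def using fin_G that by (intro member_le_sum) auto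

  \<comment> \<open>A shortest word for \<open>f ^^ n\<close> controls both quantities: each letter
    contributes one element of \<open>T\<close> to the displacement and at most \<open>C\<close>
    breaks.\<close>
  have word: "\<exists>xs. set xs \<subseteq> T \<and> length xs = ?l n \<and> (f ^^ n) x - x = sum_list xs"
    and card: "card (breaks (f ^^ n)) \<le> C * ?l n" for n x
  proof -
    obtain ws where ws: "set ws \<subseteq> ?G" "eval_word ws = f ^^ n" "length ws = ?l n"
      using word_length_attained[OF gen_subgroup_funpow[OF gen]] .
    show "\<exists>xs. set xs \<subseteq> T \<and> length xs = ?l n \<and> (f ^^ n) x - x = sum_list xs"
      using eval_word_displacement[of ws T x] ws by (fastforce simp: T_def)
    show "card (breaks (f ^^ n)) \<le> C * ?l n"
      using card_breaks_eval_word[of ws C] ws G C by auto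
  qed
  have N_le: "N ((f ^^ n) x - x) \<le> A * ?l n" for n x
  proof -
    obtain xs where xs: "set xs \<subseteq> T" "length xs = ?l n" "(f ^^ n) x - x = sum_list xs"
      using word by blast
    have "N (sum_list xs) \<le> A * length xs" using xs A by (intro sum_list_le) auto
    with xs show ?thesis by simp
  qed

  have split: "finite (split_times f p)" if "p \<in> initial_breaks f" for p
  proof (rule finite_split_times[OF f that])
    fix n\<^sub>0
    \<comment> \<open>The factor yields \<open>2 * C * ?l n \<le> n\<close>; adding 1 keeps the
      denominator positive when \<open>C = 0\<close>.\<close>
    obtain n where n: "n \<ge> n\<^sub>0" "real (?l n) \<le> 1 / (2 * C + 1) * real n"
      using frequently_small_of_liminf_zero[OF lim, of "1 / (2 * C + 1)" n\<^sub>0] by auto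
    have "2 * real C * real (?l n) \<le> (2 * real C + 1) * real (?l n)"
      by (intro mult_right_mono) auto
    also have "\<dots> \<le> real n" using n(2) by (simp add: field_simps)
    finally have "2 * (C * ?l n) \<le> n" by (metis mult.assoc of_nat_le_iff of_nat_mult of_nat_numeral)
    with card[of n] n(1) show "\<exists>n\<ge>n\<^sub>0. 2 * card (breaks (f ^^ n)) \<le> n" by force
  qed
  obtain B where B: "\<And>n x y. inner_breaks f \<inter> {..x} = inner_breaks f \<inter> {..y} \<Longrightarrow>
      N (((f ^^ n) y - y) - ((f ^^ n) x - x)) \<le> B"
    using displacement_bounded_on_cells[OF f split] by metis
  \<comment> \<open>The possible displacements of returns to a cell; \<open>0\<close> covers
    \<open>m = 0\<close>, outside the scope of \<open>return_displacement_le\<close>.\<close>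
  define V where "V = insert 0 {v. (\<exists>xs. set xs \<subseteq> T \<and> v = sum_list xs) \<and> N v \<le> B}"
  let ?cell = "\<lambda>x. inner_breaks f \<inter> {..x}"
  have V: "(f ^^ m) x - x \<in> V" if "?cell x = ?cell ((f ^^ m) x)" for m x
  proof (cases "m = 0")
    case False
    have "N ((f ^^ m) x - x) \<le> B"
    proof (rule return_displacement_le[where A = "A * ?l 1"])
      show "N (f y - y) \<le> A * ?l 1" for y using N_le[of 1 y] by simp
      show "\<exists>n\<ge>n\<^sub>0. N ((f ^^ n) x - x) \<le> \<epsilon> * real n" if "\<epsilon> > 0" for \<epsilon> n\<^sub>0
      proof -
        have pos: "\<epsilon> / (A + 1) > 0" using that A0 by simp
        obtain n where n: "n \<ge> n\<^sub>0" "real (?l n) \<le> \<epsilon> / (A + 1) * real n"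
          using frequently_small_of_liminf_zero[OF lim pos] by blast
        have "N ((f ^^ n) x - x) \<le> (A + 1) * real (?l n)"
          using N_le[of n x] by (simp add: distrib_right)
        also have "\<dots> \<le> \<epsilon> * real n" using n(2) A0 by (simp add: field_simps)
        finally show ?thesis using n(1) by blast
      qed
    qed (use B[OF that] False in auto)
    then show ?thesis using word[where n = m and x = x] by (auto simp: V_def)
  qed (simp add: V_def)
  \<comment> \<open>Neither \<open>V\<close> nor the cells depend on the starting point, so
    \<open>L\<close> bounds all orbits uniformly.\<close>
  define L where "L = card V * card (range ?cell)"
  have "\<not> inj_on (\<lambda>m. (f ^^ m) x) {..L}" for x
    unfolding L_def
  proof (rule not_inj_on_if_finite_cell_differences)
    show "finite V" using proper by (simp add: V_def)
    show "finite (range ?cell)"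
      by (rule finite_subset[of _ "Pow (inner_breaks f)"]) (auto simp: finite_inner_breaks[OF f])
    show "(f ^^ j) x - (f ^^ i) x \<in> V" if "i \<le> j" "?cell ((f ^^ i) x) = ?cell ((f ^^ j) x)" for i j
      using V[of "(f ^^ i) x" "j - i"] that by (simp flip: funpow_add_apply)
  qed
  then have "f ^^ fact L = id"
    using f by (intro finite_order_if_bounded_orbits) (auto simp: piecewise_translation_def bij_is_inj)
  with inf show False by (simp add: infinite_order_def)
qed

end
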